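(* Let $k\ge 1$ and consider a deck of $2^k$ cards. Let $i,j\in\{0,1,\dots,2^k-1\}$, and write the bitwise exclusive-or of their $k$-bit binary expansions as $i\oplus j=x_{k-1}x_{k-2}\cdots x_1x_0$, i.e. $i\oplus j=\sum_{r=0}^{k-1}x_r2^r$ with $x_r\in\{0,1\}$. Define shuffles $S_0,S_1,\dots,S_{k-1}$ as follows: (1) if $k$ is odd, $S_r=L$ if $x_r=0$ and $S_r=R$ if $x_r=1$; (2) if $k$ is even, $S_r=R$ if $x_r=0$ and $S_r=L$ if $x_r=1$. Then performing the $k$ shuffles $S_0,S_1,\dots,S_{k-1}$ in this order ($S_0$ first) swaps the cards in positions $i$ and $j$; that is, the permutation $S_{k-1}\circ\cdots\circ S_1\circ S_0$ sends $i$ to $j$ and $j$ to $i$.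
   Context: Cards in a deck of $2n$ cards are indexed by their distance from the top: positions $0,1,\dots,2n-1$ (here $2n=2^k$). A shuffle is identified with the permutation of $\{0,\dots,2n-1\}$ sending the position of a card before the shuffle to its position after. Left and right shuffles: deal the deck from the top alternately into two piles (first card to the left pile), then put the left pile on top of the right ($L$) or the right pile on top of the left ($R$). Explicitly, $L(i)=n-1-\tfrac{i}{2}$ for $i$ even, $L(i)=2n-\tfrac{i+1}{2}$ for $i$ odd; $R(i)=2n-1-\tfrac{i}{2}$ for $i$ even, $R(i)=n-\tfrac{i+1}{2}$ for $i$ odd. *)

theory Defs
  imports Main
begin

text \<open>Shuffles of a deck of \<open>2 * n\<close> cards, as maps from the position of a card before the shuffle to
  its position after it; position \<open>0\<close> is the top. Each shuffle is the identity outside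
  \<open>{..<2 * n}\<close>, so that it is a permutation of this set in the sense of \<open>permutes\<close>.\<close>

definition left_shuffle :: "nat \<Rightarrow> nat \<Rightarrow> nat" where
  "left_shuffle n i =
     (if i < 2 * n then
        if even i then n - 1 - i div 2 else 2 * n - (i + 1) div 2
      else i)"

definition right_shuffle :: "nat \<Rightarrow> nat \<Rightarrow> nat" where
  "right_shuffle n i =
     (if i < 2 * n then
        if even i then 2 * n - 1 - i div 2 else n - (i + 1) div 2
      else i)"

unbundle bit_operations_syntax

end

theory Submission
  imports Defs
begin

text \<open>
  Let the deck have \<open>2 ^ k\<close> cards and write positions with \<open>k\<close> bits. Both shuffles rotate the bits of a
  position cyclically, each bit moving down by one and the lowest one moving to the top. A right shuffle
  also complements all bits; a left shuffle complements all but the one that moved to the top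
  (\<open>bit_right_shuffle\<close>, \<open>bit_left_shuffle\<close>).

  After \<open>k\<close> shuffles the rotation has gone full circle and every bit is back at its place. Bit \<open>r\<close>
  wraps around in the shuffle \<open>S r\<close>. The other \<open>k - 1\<close> shuffles complement it, and \<open>S r\<close> does so
  exactly if it is a right shuffle. Hence the type of \<open>S r\<close> decides whether bit \<open>r\<close> is changed in the
  end, and the rule in the theorem, which depends on the parity of \<open>k\<close> because of these \<open>k - 1\<close>
  complementations, picks the type that changes precisely the bits in which \<open>i\<close> and \<open>j\<close> differ. So \<open>i\<close>
  goes to \<open>j\<close>, and as the rule is symmetric in \<open>i\<close> and \<open>j\<close>, also \<open>j\<close> goes to \<open>i\<close>.
\<close>

section \<open>Shuffles as operations on bits\<close>

text \<open>Subtraction from a block of ones never borrows, so it complements each bit separately.\<close>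

lemma bit_mask_minus:
  fixes a :: nat
  assumes "a < 2 ^ k"
  shows "bit (2 ^ k - 1 - a) m \<longleftrightarrow> m < k \<and> \<not> bit a m"
proof -
  have high: "\<not> bit a l" if "k \<le> l" for l
    using assms that by (metis bit_take_bit_iff not_less take_bit_nat_eq_self)
  have "a AND (mask k XOR a) = 0"
    by (rule bit_eqI) (use high in \<open>auto simp: bit_simps simp flip: not_le\<close>)
  then have "a + (mask k XOR a) = a XOR (mask k XOR a)"
    by (rule disjunctive_add_eq_xor)
  also have "\<dots> = mask k"
    by (rule bit_eqI) (auto simp: bit_simps)
  finally have "2 ^ k - 1 - a = mask k XOR a"
    by (simp add: mask_eq_exp_minus_1)
  then show ?thesis
    using high[of m] by (auto simp: bit_simps)
qed

lemma bit_div_2_plus_top: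
  fixes p :: nat
  assumes "p < 2 ^ Suc q"
  shows "bit (p div 2 + of_bool c * 2 ^ q) m \<longleftrightarrow> (if m = q then c else bit p (Suc m))"
proof -
  have "p div 2 < 2 ^ q"
    using assms by auto
  then have high: "\<not> bit (p div 2) l" if "q \<le> l" for l
    using that by (metis bit_take_bit_iff not_less take_bit_nat_eq_self)
  have "p div 2 AND of_bool c * 2 ^ q = 0"
    by (rule bit_eqI) (use high in \<open>auto simp: bit_simps\<close>)
  then have "p div 2 + of_bool c * 2 ^ q = p div 2 OR of_bool c * 2 ^ q"
    by (rule disjunctive_add_eq_or)
  then show ?thesis
    using high[of q] by (auto simp: bit_or_iff bit_exp_iff bit_Suc)
qed

text \<open>Both shuffles are the complement of a halved position with a new top bit; they differ only in
  that bit.\<close>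

lemma bit_complement_div_2_plus_top:
  fixes p :: nat
  assumes "p < 2 ^ Suc q" and "m \<le> q"
  shows "bit (2 ^ Suc q - 1 - (p div 2 + of_bool c * 2 ^ q)) m \<longleftrightarrow>
    \<not> (if m = q then c else bit p (Suc m))"
proof -
  have "p div 2 < 2 ^ q"
    using assms(1) by auto
  then have "p div 2 + of_bool c * 2 ^ q < 2 ^ Suc q"
    by simp
  from bit_mask_minus[OF this, of m] show ?thesis
    using bit_div_2_plus_top[OF assms(1), of c m] assms(2) by simp
qed

lemma bit_right_shuffle:
  assumes "p < 2 ^ Suc q" and "m \<le> q"
  shows "bit (right_shuffle (2 ^ q) p) m \<longleftrightarrow> \<not> bit p (if m = q then 0 else Suc m)"
proof -
  have "right_shuffle (2 ^ q) p = 2 ^ Suc q - 1 - (p div 2 + of_bool (odd p) * 2 ^ q)"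
    using assms(1) by (auto simp: right_shuffle_def elim!: oddE)
  then show ?thesis
    using bit_complement_div_2_plus_top[OF assms, of "odd p"] by (simp add: bit_0)
qed

lemma bit_left_shuffle:
  assumes "p < 2 ^ Suc q" and "m \<le> q"
  shows "bit (left_shuffle (2 ^ q) p) m \<longleftrightarrow> (if m = q then bit p 0 else \<not> bit p (Suc m))"
proof -
  have "left_shuffle (2 ^ q) p = 2 ^ Suc q - 1 - (p div 2 + of_bool (even p) * 2 ^ q)"
    using assms(1) by (auto simp: left_shuffle_def elim!: oddE)
  then show ?thesis
    using bit_complement_div_2_plus_top[OF assms, of "even p"] by (simp add: bit_0)
qed

lemma right_shuffle_less: "p < 2 * n \<Longrightarrow> right_shuffle n p < 2 * n"
  by (auto simp: right_shuffle_def)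

lemma left_shuffle_less: "p < 2 * n \<Longrightarrow> left_shuffle n p < 2 * n"
  by (auto simp: left_shuffle_def elim!: oddE)

section \<open>Sequences of shuffles\<close>

text \<open>
  After \<open>t\<close> shuffles, the bit that started at place \<open>r\<close> is at place \<open>r - t\<close> modulo \<open>k\<close>. If it has not
  wrapped around yet, it has been complemented \<open>t\<close> times. If it has, it is the bit of the destination
  up to the \<open>k - t\<close> complementations still to come: the hypothesis on \<open>S r\<close> says
  that it wraps around with just the value that makes this true. Counting from the destination avoids
  following the effect of the single wrap-around through the later shuffles.
\<close>

lemma bit_fold_shuffles:
  fixes k i j t m :: nat
  assumes "i < 2 ^ k" and "t \<le> k" and "m < k"
    and less: "\<And>r p. r < k \<Longrightarrow> p < 2 ^ k \<Longrightarrow> S r p < 2 ^ k"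
    and shift: "\<And>r p m. r < k \<Longrightarrow> p < 2 ^ k \<Longrightarrow> Suc m < k \<Longrightarrow> bit (S r p) m \<longleftrightarrow> \<not> bit p (Suc m)"
    and wrap: "\<And>r p. r < k \<Longrightarrow> p < 2 ^ k \<Longrightarrow>
      bit (S r p) (k - 1) \<longleftrightarrow> bit p 0 \<noteq> ((bit i r \<noteq> bit j r) \<noteq> even k)"
  shows "fold S [0..<t] i < 2 ^ k \<and>
    (bit (fold S [0..<t] i) m \<longleftrightarrow>
      (if m + t < k then bit i (m + t) \<noteq> odd t else bit j (m + t - k) \<noteq> odd (k - t)))"
  using assms(2,3)
proof (induction t arbitrary: m)
  case 0
  then show ?case
    using assms(1) by simp
next
  case (Suc t)
  define p where "p = fold S [0..<t] i"
  have p: "p < 2 ^ k"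
    and IH: "\<And>m. m < k \<Longrightarrow> bit p m \<longleftrightarrow>
      (if m + t < k then bit i (m + t) \<noteq> odd t else bit j (m + t - k) \<noteq> odd (k - t))"
    using Suc by (auto simp: p_def)
  have step: "fold S [0..<Suc t] i = S t p"
    by (simp add: p_def)
  have "bit (S t p) m \<longleftrightarrow>
      (if m + Suc t < k then bit i (m + Suc t) \<noteq> odd (Suc t)
       else bit j (m + Suc t - k) \<noteq> odd (k - Suc t))"
  proof (cases "Suc m < k")
    case True
    then show ?thesis
      using shift[of t p m] IH[of "Suc m"] p Suc.prems by auto
  next
    case False
    then have m: "m = k - 1"
      using Suc.prems by simp
    have "bit p 0 \<longleftrightarrow> bit i t \<noteq> odd t"
      using IH[of 0] Suc.prems by simp
    then show ?thesis
      using wrap[of t p] p Suc.prems m by auto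
  qed
  then show ?case
    using less[of t p] p Suc.prems step by simp
qed

lemma fold_shuffles_eq:
  fixes k i j :: nat
  assumes "i < 2 ^ k" and "j < 2 ^ k"
    and less: "\<And>r p. r < k \<Longrightarrow> p < 2 ^ k \<Longrightarrow> S r p < 2 ^ k"
    and shift: "\<And>r p m. r < k \<Longrightarrow> p < 2 ^ k \<Longrightarrow> Suc m < k \<Longrightarrow> bit (S r p) m \<longleftrightarrow> \<not> bit p (Suc m)"
    and wrap: "\<And>r p. r < k \<Longrightarrow> p < 2 ^ k \<Longrightarrow>
      bit (S r p) (k - 1) \<longleftrightarrow> bit p 0 \<noteq> ((bit i r \<noteq> bit j r) \<noteq> even k)"
  shows "fold S [0..<k] i = j"
proof (cases "k = 0")
  case True
  then show ?thesis
    using assms(1,2) by simp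
next
  case False
  note final = bit_fold_shuffles[where t = k, OF assms(1) order_refl _ less shift wrap]
  have "take_bit k (fold S [0..<k] i) = take_bit k j"
  proof (rule bit_eqI)
    show "bit (take_bit k (fold S [0..<k] i)) m \<longleftrightarrow> bit (take_bit k j) m" for m
      using final[of m] by (auto simp: bit_take_bit_iff)
  qed
  moreover have "fold S [0..<k] i < 2 ^ k"
    using final[of 0] False by simp
  ultimately show ?thesis
    using assms(2) by (simp add: take_bit_nat_eq_self)
qed

lemma bit_sum_digits:
  fixes x :: "nat \<Rightarrow> nat"
  assumes "\<And>r. r < k \<Longrightarrow> x r \<in> {0, 1}" and "m < k"
  shows "bit (\<Sum>r<k. x r * 2 ^ r) m \<longleftrightarrow> x m = 1"
proof -
  have "(\<Sum>r<k. x r * 2 ^ r) = (\<Sum>r<k. of_bool (x r = 1) * 2 ^ r)"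
    using assms(1) by (intro sum.cong) fastforce+
  also have "\<dots> = horner_sum of_bool 2 (map (\<lambda>r. x r = 1) [0..<k])"
    by (simp add: horner_sum_eq_sum atLeast0LessThan)
  finally show ?thesis
    using assms(2) by (simp add: bit_horner_sum_bit_iff)
qed

theorem theorem3p3:
  fixes k n i j :: nat
    and x :: "nat \<Rightarrow> nat"
    and S :: "nat \<Rightarrow> nat \<Rightarrow> nat"
  assumes "k \<ge> 1" and "2 * n = 2 ^ k"
    and "i < 2 ^ k" and "j < 2 ^ k"
    and "\<And>r. r < k \<Longrightarrow> x r \<in> {0, 1}"
    and "i XOR j = (\<Sum>r<k. x r * 2 ^ r)"
    and "\<And>r. r < k \<Longrightarrow> odd k \<Longrightarrow> S r = (if x r = 0 then left_shuffle n else right_shuffle n)"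
    and "\<And>r. r < k \<Longrightarrow> even k \<Longrightarrow> S r = (if x r = 0 then right_shuffle n else left_shuffle n)"
  shows "fold S [0..<k] i = j \<and> fold S [0..<k] j = i"
proof -
  obtain q where k: "k = Suc q"
    using assms(1) by (cases k) auto
  have n: "n = 2 ^ q"
    using assms(2) k by simp
  have differ: "x r = 1 \<longleftrightarrow> bit i r \<noteq> bit j r" if "r < k" for r
    using bit_sum_digits[of k x r] assms(5) that by (simp add: bit_xor_iff flip: assms(6))
  have S: "S r = (if (bit i r \<noteq> bit j r) \<noteq> even k then right_shuffle n else left_shuffle n)"
    if "r < k" for r
    using assms(5,7,8)[OF that] differ[OF that] by auto
  have less: "S r p < 2 ^ k" if "r < k" "p < 2 ^ k" for r p
    using that assms(2) right_shuffle_less[of p n] left_shuffle_less[of p n] by (simp add: S)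
  have shift: "bit (S r p) m \<longleftrightarrow> \<not> bit p (Suc m)" if "r < k" "p < 2 ^ k" "Suc m < k" for r p m
    using that bit_right_shuffle[of p q m] bit_left_shuffle[of p q m] unfolding S[OF that(1)]
    by (simp add: k n)
  have wrap: "bit (S r p) (k - 1) \<longleftrightarrow> bit p 0 \<noteq> ((bit i r \<noteq> bit j r) \<noteq> even k)"
    if "r < k" "p < 2 ^ k" for r p
    using that bit_right_shuffle[of p q q] bit_left_shuffle[of p q q] unfolding S[OF that(1)]
    by (auto simp: k n)
  show ?thesis
  proof
    show "fold S [0..<k] i = j"
      by (rule fold_shuffles_eq[OF assms(3,4) less shift wrap])
    show "fold S [0..<k] j = i"
      by (rule fold_shuffles_eq[OF assms(4,3) less shift]) (use wrap in auto)
  qed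
qed

end
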